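(* For all positive integers $n$ and $q$ and every subset $B\subseteq\{q,\dots,n+q-2\}$, $$\sum_{\{\pi^{-1}\in Avoid_q(n+q-1)\mid Des_q(\pi^{-1})=B\}} t^{rmaj_{q,n+q-1}(\pi)}=\sum_{\{\pi^{-1}\in Avoid_q(n+q-1)\mid Des_q(\pi^{-1})=B\}} t^{inv_q(\pi)},$$ where both sums are over all $\pi\in S_{n+q-1}$ with $\pi^{-1}\in Avoid_q(n+q-1)$ and $Des_q(\pi^{-1})=B$.
   Context: $t$ is an indeterminate. Let $m=n+q-1$ and $\pi\in S_m$. The $q$-inversion number: $inv_q(\pi)=\sum_{i=q+1}^m \min\{\,i-q,\ \#\{j<i\mid \pi(j)>\pi(i)\}\,\}$ (equal to $0$ if $m\le q$). $Del_q(\pi)=\{ i \mid q+1\le i\le m,\ \#\{j<i\mid \pi(j)<\pi(i)\}\le q-1\}$. The $q$-descent set $Des_q(\pi)$ is the set of $i$ with $q\le i\le m-1$ such that $\pi(i)>\pi(i+1)$ or $i+1\in Del_q(\pi)$ (or both). The $q$-reverse major index: $rmaj_{q,m}(\pi)=\sum_{i\in Des_q(\pi)}(m-i)$. $Pat(q)=\{(\sigma_1-\sigma_2-\cdots-\sigma_q-(q+2)(q+1))\mid \sigma\in S_q\}$ is a set of $q!$ dashed patterns. A permutation $\pi\in S_m$ contains the pattern $(\sigma_1-\cdots-\sigma_q-(q+2)(q+1))$ if there are positions $1\le i_1<\cdots<i_q<i_{q+1}<m$ such that $\pi(i_1),\dots,\pi(i_q),\pi(i_{q+1}),\pi(i_{q+1}+1)$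 is order-isomorphic to $\sigma_1,\dots,\sigma_q,q+2,q+1$; otherwise it avoids the pattern. $Avoid_q(m)$ is the set of permutations in $S_m$ avoiding all patterns in $Pat(q)$. *)

theory Defs
  imports "HOL-Combinatorics.Permutations" "HOL-Computational_Algebra.Polynomial"
begin

text \<open>Elements of \<open>S\<^sub>m\<close> are the functions \<open>\<pi> :: nat \<Rightarrow> nat\<close> with \<open>\<pi> permutes {1..m}\<close>,
  so positions and values are counted from 1.\<close>

definition inv_q :: "nat \<Rightarrow> nat \<Rightarrow> (nat \<Rightarrow> nat) \<Rightarrow> nat" where
  "inv_q q m \<pi> = (\<Sum>i = q + 1..m. min (i - q) (card {j \<in> {1..<i}. \<pi> j > \<pi> i}))"

definition Del_q :: "nat \<Rightarrow> nat \<Rightarrow> (nat \<Rightarrow> nat) \<Rightarrow> nat set" where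
  "Del_q q m \<pi> = {i \<in> {q + 1..m}. card {j \<in> {1..<i}. \<pi> j < \<pi> i} \<le> q - 1}"

definition Des_q :: "nat \<Rightarrow> nat \<Rightarrow> (nat \<Rightarrow> nat) \<Rightarrow> nat set" where
  "Des_q q m \<pi> = {i \<in> {q..m - 1}. \<pi> i > \<pi> (i + 1) \<or> i + 1 \<in> Del_q q m \<pi>}"

definition rmaj_q :: "nat \<Rightarrow> nat \<Rightarrow> (nat \<Rightarrow> nat) \<Rightarrow> nat" where
  "rmaj_q q m \<pi> = (\<Sum>i \<in> Des_q q m \<pi>. m - i)"

definition order_isomorphic :: "nat list \<Rightarrow> nat list \<Rightarrow> bool" where
  "order_isomorphic xs ys \<longleftrightarrow> length xs = length ys \<and>
     (\<forall>a < length xs. \<forall>b < length xs. xs ! a < xs ! b \<longleftrightarrow> ys ! a < ys ! b)"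

text \<open>A pattern \<open>\<sigma>\<^sub>1-\<dots>-\<sigma>\<^sub>q-(q+2)(q+1)\<close> is represented by its word of length \<open>q + 2\<close>. The dashes
  are not recorded: every pattern in \<open>Pat q\<close> has them everywhere except between the last two letters,
  and \<open>contains_pat\<close> accordingly requires adjacency of exactly the last two positions.\<close>

definition Pat :: "nat \<Rightarrow> nat list set" where
  "Pat q = {map \<sigma> [1..<q + 1] @ [q + 2, q + 1] | \<sigma>. \<sigma> permutes {1..q}}"

definition contains_pat :: "nat \<Rightarrow> nat \<Rightarrow> (nat \<Rightarrow> nat) \<Rightarrow> nat list \<Rightarrow> bool" where
  "contains_pat q m \<pi> p \<longleftrightarrow>
     (\<exists>i :: nat \<Rightarrow> nat. 1 \<le> i 1 \<and> strict_mono_on {1..q + 1} i \<and> i (q + 1) < m \<and>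
        order_isomorphic (map (\<lambda>k. \<pi> (i k)) [1..<q + 2] @ [\<pi> (i (q + 1) + 1)]) p)"

definition Avoid_q :: "nat \<Rightarrow> nat \<Rightarrow> (nat \<Rightarrow> nat) set" where
  "Avoid_q q m = {\<pi>. \<pi> permutes {1..m} \<and> (\<forall>p \<in> Pat q. \<not> contains_pat q m \<pi> p)}"

end

theory Submission
  imports Defs
begin

text \<open>
  Write \<open>\<sigma>\<close> for the inverse of \<open>\<pi>\<close>. In the word \<open>\<pi>(1) \<dots> \<pi>(m)\<close>, the value \<open>\<sigma>(k)\<close> is the
  position of the letter \<open>k\<close>, so conditions on \<open>\<sigma>\<close> restrict where each letter stands among the
  smaller ones. Avoiding \<open>Pat q\<close> says that every descent of \<open>\<sigma>\<close> from \<open>k \<ge> q\<close> to \<open>k + 1\<close> has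
  \<open>k + 1 \<in> Del\<^sub>q \<sigma>\<close>. Together with \<open>Des\<^sub>q \<sigma> = B\<close> this becomes a recipe for building the
  word by inserting the letters \<open>q + 1, \<dots>, m\<close> in increasing order
  (\<open>Avoid_q_Des_q_eq_run_class\<close>): the letter \<open>k + 1\<close> goes into one of the first \<open>q\<close> gaps if
  \<open>k \<in> B\<close>, and otherwise into any gap that has at least \<open>q\<close> letters, among them \<open>k\<close>, on its left.
  The letters thus come in runs, and a new run begins exactly at the letters \<open>k + 1\<close> with \<open>k \<in> B\<close>.

  Now follow a statistic during the insertions. Suppose that the current word has length \<open>i\<close>.
  Inserting \<open>i + 1\<close> into one of the first \<open>q\<close> gaps adds \<open>i + 1 - q\<close> to both statistics. Inserting
  it after \<open>g \<ge> q\<close> letters adds \<open>i - g\<close> to \<open>inv\<^sub>q\<close>; it adds to \<open>rmaj\<^sub>q\<close> the number of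
  \<open>q\<close>-descents before \<open>g\<close>, and moreover \<open>i - g\<close> if \<open>g\<close> was not a \<open>q\<close>-descent. Both rules are
  instances of one rule with a set \<open>X\<close> of marked positions (\<open>insertion_statistic\<close>), where
  \<open>X = {}\<close> for \<open>inv\<^sub>q\<close> and \<open>X\<close> is the set of \<open>q\<close>-descents for \<open>rmaj\<^sub>q\<close>.

  What makes the two distributions agree is that, summed over all ways to complete a run, the marks
  behind the last inserted letter do not matter: if \<open>r\<close> letters of the run are still to come and
  \<open>K\<close> letters stand to the right of the last one inserted, then those \<open>r\<close> letters contribute a
  Gaussian binomial coefficient \<open>K + r\<close> over \<open>r\<close>, and each mark to the left of the last one
  inserted is counted \<open>r\<close> times. The induction step is the identity \<open>sum_gauss_binom_marked\<close>, in which a marked gap uses one \<open>t\<close>-analogue of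
  Pascal's rule and an unmarked gap uses the other. Peeling off the letters from \<open>m\<close> down to
  \<open>q + 1\<close> expresses both sums by the words of length \<open>q\<close>, on which both statistics vanish.
\<close>

section \<open>Gaussian binomial coefficients\<close>

text \<open>\<open>gauss_binom t K c\<close> is the Gaussian binomial coefficient of \<open>K + c\<close> over \<open>c\<close> at \<open>t\<close>. The
  parameter \<open>K\<close> is separate because it will be the number of letters to the right of the
  insertion point and \<open>c\<close> the number of letters to be inserted there; in these parameters both
  Pascal rules are recursions without subtraction.\<close>
fun gauss_binom :: "'a::comm_semiring_1 \<Rightarrow> nat \<Rightarrow> nat \<Rightarrow> 'a" where
  "gauss_binom t K 0 = 1"
| "gauss_binom t 0 (Suc c) = 1"
| "gauss_binom t (Suc K) (Suc c) = gauss_binom t (Suc K) c + t ^ Suc c * gauss_binom t K (Suc c)"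

lemma gauss_binom_0_left [simp]: "gauss_binom t 0 c = 1"
  by (cases c) auto

text \<open>The mirror image of the defining recursion. Expanding both summands of the recursion by the
  induction hypothesis and regrouping the four terms folds them back into the claim.\<close>
lemma gauss_binom_Suc_Suc':
  "gauss_binom t (Suc K) (Suc c) = t ^ Suc K * gauss_binom t (Suc K) c + gauss_binom t K (Suc c)"
proof (induction "K + c" arbitrary: K c rule: less_induct)
  case less
  let ?G = "gauss_binom t"
  note rec = gauss_binom.simps(3)[of t]
  show ?case
  proof (cases K)
    case 0
    show ?thesis
    proof (cases c)
      case c: (Suc d)
      have "?G (Suc 0) (Suc c) = t * ?G (Suc 0) d + 1 + t ^ Suc c"
        using less[of 0 d] 0 by (simp add: c)
      also have "\<dots> = t * (?G (Suc 0) d + t ^ c) + 1"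
        by (simp add: algebra_simps)
      also have "?G (Suc 0) d + t ^ c = ?G (Suc 0) c"
        by (simp add: c)
      finally show ?thesis by (simp add: 0)
    qed (simp add: 0 add.commute)
  next
    case K: (Suc k)
    show ?thesis
    proof (cases c)
      case 0
      have "?G (Suc K) 1 = 1 + t * ?G K 1"
        using rec[of K 0] by simp
      also have "?G K 1 = t ^ K + ?G k 1"
        using less[of k 0] 0 by (simp only: K) simp
      also have "1 + t * (t ^ K + ?G k 1) = t ^ Suc K + (1 + t * ?G k 1)"
        by (simp add: algebra_simps)
      also have "1 + t * ?G k 1 = ?G K 1"
        using rec[of k 0] by (simp add: K)
      finally show ?thesis by (simp only: 0 One_nat_def gauss_binom.simps(1) mult_1_right)
    next
      case c: (Suc d)
      have "?G (Suc K) (Suc c) = ?G (Suc K) c + t ^ Suc c * ?G K (Suc c)"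
        by (rule rec)
      also have "?G (Suc K) c = t ^ Suc K * ?G (Suc K) d + ?G K c"
        using less[of K d] by (simp add: c)
      also have "?G K (Suc c) = t ^ K * ?G K c + ?G k (Suc c)"
        using less[of k c] by (simp add: K)
      also have "t ^ Suc K * ?G (Suc K) d + ?G K c + t ^ Suc c * (t ^ K * ?G K c + ?G k (Suc c))
          = t ^ Suc K * (?G (Suc K) d + t ^ c * ?G K c) + (?G K c + t ^ Suc c * ?G k (Suc c))"
        by (simp only: distrib_left power_Suc ac_simps)
      also have "?G (Suc K) d + t ^ c * ?G K c = ?G (Suc K) c"
        using rec[of K d] by (simp only: c)
      also have "?G K c + t ^ Suc c * ?G k (Suc c) = ?G K (Suc c)"
        using rec[of k c] by (simp only: K)
      finally show ?thesis .
    qed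
  qed
qed

text \<open>Here \<open>g\<close> is the gap chosen for the next letter of a run, \<open>X\<close> the set of marked positions and
  \<open>r\<close> the number of letters of the run still to come afterwards. The value on the right does not
  depend on \<open>X\<close>. Splitting off the leftmost gap \<open>a\<close> shows why: if \<open>a\<close> is marked, then all other
  summands carry a factor \<open>t ^ Suc r\<close>; if it is not, then the summand of \<open>a\<close> itself carries a factor
  \<open>t ^ (i - a)\<close>. These are the two Pascal rules.\<close>
lemma sum_gauss_binom_marked:
  fixes t :: "'a::comm_semiring_1"
  assumes "a \<le> i"
  shows "(\<Sum>g=a..i. t ^ (Suc r * card {d \<in> X. a \<le> d \<and> d < g} + (if g \<in> X then 0 else i - g))
            * gauss_binom t (i - g) r) = gauss_binom t (i - a) (Suc r)"
  using assms
proof (induction rule: inc_induct)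
  case base
  have empty: "{d \<in> X. i \<le> d \<and> d < i} = {}" by auto
  show ?case unfolding atLeastAtMost_singleton by (simp add: empty)
next
  case (step a)
  have empty: "{d \<in> X. a \<le> d \<and> d < a} = {}" by auto
  let ?N = "\<lambda>a g. card {d \<in> X. a \<le> d \<and> d < g}"
  let ?f = "\<lambda>a g. t ^ (Suc r * ?N a g + (if g \<in> X then 0 else i - g)) * gauss_binom t (i - g) r"
  have N: "?N a g = (if a \<in> X then 1 else 0) + ?N (Suc a) g" if "a < g" for g
  proof -
    have "{d \<in> X. a \<le> d \<and> d < g} = (if a \<in> X then {a} else {}) \<union> {d \<in> X. Suc a \<le> d \<and> d < g}"
      using that by (auto simp: Suc_le_eq order.order_iff_strict)
    moreover have "finite {d \<in> X. Suc a \<le> d \<and> d < g}"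
      by (rule finite_subset[of _ "{..<g}"]) auto
    ultimately show ?thesis by auto
  qed
  have "(\<Sum>g=a..i. ?f a g) = ?f a a + (\<Sum>g=Suc a..i. ?f a g)"
    using step.hyps by (simp add: sum.atLeast_Suc_atMost)
  also have "(\<Sum>g=Suc a..i. ?f a g)
      = (\<Sum>g=Suc a..i. t ^ (if a \<in> X then Suc r else 0) * ?f (Suc a) g)"
  proof (rule sum.cong)
    fix g assume "g \<in> {Suc a..i}"
    then show "?f a g = t ^ (if a \<in> X then Suc r else 0) * ?f (Suc a) g"
      using N[of g] by (simp add: power_add algebra_simps)
  qed simp
  also have "\<dots> = t ^ (if a \<in> X then Suc r else 0) * gauss_binom t (i - Suc a) (Suc r)"
    by (simp only: sum_distrib_left[symmetric] step.IH)
  also have "?f a a = t ^ (if a \<in> X then 0 else i - a) * gauss_binom t (i - a) r"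
    by (simp add: empty)
  also have "t ^ (if a \<in> X then 0 else i - a) * gauss_binom t (i - a) r
        + t ^ (if a \<in> X then Suc r else 0) * gauss_binom t (i - Suc a) (Suc r)
      = gauss_binom t (i - a) (Suc r)"
  proof -
    obtain K where K: "i - a = Suc K" "i - Suc a = K"
      using step.hyps by (metis Suc_diff_Suc)
    show ?thesis
      using gauss_binom_Suc_Suc'[of t K r] unfolding K by (cases "a \<in> X") simp_all
  qed
  finally show ?case .
qed

section \<open>Appending a letter to a permutation\<close>

text \<open>If \<open>\<sigma> v\<close> is the position of the letter \<open>v\<close> in a word of length \<open>i\<close>, then
  \<open>open_gap i g \<circ> \<sigma>\<close> gives the positions after the letter \<open>Suc i\<close> has been inserted behind the
  first \<open>g\<close> letters. The first three branches permute \<open>{1..Suc i}\<close>; the last one keeps the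
  function the identity elsewhere.\<close>
definition open_gap :: "nat \<Rightarrow> nat \<Rightarrow> nat \<Rightarrow> nat" where
  "open_gap i g v =
     (if v \<le> g then v else if v \<le> i then Suc v else if v = Suc i then Suc g else v)"

lemma open_gap_permutes:
  assumes "g \<le> i"
  shows "open_gap i g permutes {1..Suc i}"
proof (rule bij_imp_permutes)
  have "inj_on (open_gap i g) {1..Suc i}"
    using assms by (auto simp: inj_on_def open_gap_def split: if_splits)
  moreover have "open_gap i g ` {1..Suc i} \<subseteq> {1..Suc i}"
    using assms by (auto simp: open_gap_def)
  ultimately show "bij_betw (open_gap i g) {1..Suc i} {1..Suc i}"
    by (simp add: bij_betw_def endo_inj_surj)
qed (use assms in \<open>auto simp: open_gap_def\<close>)

lemma open_gap_less_iff:
  assumes "a \<le> i" "b \<le> i"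
  shows "open_gap i g a < open_gap i g b \<longleftrightarrow> a < b"
  using assms by (auto simp: open_gap_def)

lemma permutes_atMost_Suc:
  assumes "\<sigma> permutes {1..i}" shows "\<sigma> permutes {1..Suc i}"
  using permutes_subset[OF assms, of "{1..Suc i}"] by auto

lemma append_permutes:
  assumes "\<sigma> permutes {1..i}" "g \<le> i"
  shows "open_gap i g \<circ> \<sigma> permutes {1..Suc i}"
  using assms by (intro permutes_compose permutes_atMost_Suc open_gap_permutes)

lemma append_last:
  assumes "\<sigma> permutes {1..i}" "g \<le> i"
  shows "(open_gap i g \<circ> \<sigma>) (Suc i) = Suc g"
  using assms permutes_not_in[OF assms(1), of "Suc i"] by (simp add: open_gap_def)

lemma permutes_le:
  fixes \<sigma> :: "nat \<Rightarrow> nat"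
  assumes "\<sigma> permutes {1..i}" "a \<le> i"
  shows "\<sigma> a \<le> i"
proof (cases "a = 0")
  case True
  then show ?thesis using permutes_not_in[OF assms(1), of 0] by simp
next
  case False
  then show ?thesis using permutes_in_image[OF assms(1), of a] assms(2) by simp
qed

lemma append_less_iff:
  assumes "\<sigma> permutes {1..i}" "a \<le> i" "b \<le> i"
  shows "(open_gap i g \<circ> \<sigma>) a < (open_gap i g \<circ> \<sigma>) b \<longleftrightarrow> \<sigma> a < \<sigma> b"
  using assms by (simp add: open_gap_less_iff permutes_le)

lemma bij_betw_append:
  "bij_betw (\<lambda>(\<sigma>, g). open_gap i g \<circ> \<sigma>) ({\<sigma>. \<sigma> permutes {1..i}} \<times> {..i})
     {\<tau>. \<tau> permutes {1..Suc i}}"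
proof (rule bij_betwI')
  fix x y assume xy: "x \<in> {\<sigma>. \<sigma> permutes {1..i}} \<times> {..i}" "y \<in> {\<sigma>. \<sigma> permutes {1..i}} \<times> {..i}"
  obtain \<sigma> g \<tau> h where eq: "x = (\<sigma>, g)" "y = (\<tau>, h)" by (metis prod.exhaust)
  have "\<sigma> = \<tau> \<and> g = h" if "open_gap i g \<circ> \<sigma> = open_gap i h \<circ> \<tau>"
  proof -
    have "g = h" using append_last[of \<sigma> i g] append_last[of \<tau> i h] xy that by (simp add: eq)
    moreover have "inj (open_gap i g)"
      using xy by (auto simp: eq intro!: permutes_inj open_gap_permutes)
    ultimately show ?thesis using that by (simp add: fun.inj_map_strong fun_eq_iff inj_eq)
  qed
  then show "((case x of (\<sigma>, g) \<Rightarrow> open_gap i g \<circ> \<sigma>) = (case y of (\<sigma>, g) \<Rightarrow> open_gap i g \<circ> \<sigma>)) = (x = y)"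
    by (auto simp: eq)
next
  fix x assume "x \<in> {\<sigma>. \<sigma> permutes {1..i}} \<times> {..i}"
  then show "(case x of (\<sigma>, g) \<Rightarrow> open_gap i g \<circ> \<sigma>) \<in> {\<tau>. \<tau> permutes {1..Suc i}}"
    by (auto simp del: One_nat_def intro!: append_permutes)
next
  fix \<tau> :: "nat \<Rightarrow> nat" assume "\<tau> \<in> {\<tau>. \<tau> permutes {1..Suc i}}"
  then have \<tau>: "\<tau> permutes {1..Suc i}" by simp
  define g where "g = \<tau> (Suc i) - 1"
  have last: "\<tau> (Suc i) = Suc g" "g \<le> i"
    using permutes_in_image[OF \<tau>, of "Suc i"] by (auto simp: g_def)
  have og: "open_gap i g permutes {1..Suc i}" using last(2) by (rule open_gap_permutes)
  define \<sigma> where "\<sigma> = inv (open_gap i g) \<circ> \<tau>"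
  have "\<sigma> permutes {1..Suc i}"
    unfolding \<sigma>_def by (intro permutes_compose \<tau> permutes_inv og)
  moreover have "\<sigma> (Suc i) = Suc i"
    using last by (simp add: \<sigma>_def permutes_inv_eq[OF og] open_gap_def)
  ultimately have "\<sigma> permutes {1..i}"
    using permutes_superset[of \<sigma> "{1..Suc i}" "{1..i}"] by (auto simp: le_Suc_eq)
  moreover have "\<tau> = open_gap i g \<circ> \<sigma>"
    by (simp add: \<sigma>_def fun_eq_iff permutes_inverses[OF og])
  ultimately show "\<exists>x\<in>{\<sigma>. \<sigma> permutes {1..i}} \<times> {..i}. \<tau> = (case x of (\<sigma>, g) \<Rightarrow> open_gap i g \<circ> \<sigma>)"
    using last(2) by (intro bexI[of _ "(\<sigma>, g)"]) auto
qed

section \<open>The permutations to be summed over\<close>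

definition num_smaller :: "(nat \<Rightarrow> nat) \<Rightarrow> nat \<Rightarrow> nat" where
  "num_smaller \<sigma> k = card {j \<in> {1..<k}. \<sigma> j < \<sigma> k}"

text \<open>The inverses of the words that arise when the letters above \<open>q\<close> are inserted in runs, a new
  run starting at \<open>Suc k\<close> precisely for \<open>k \<in> B\<close>. Since \<open>\<sigma>\<close> is the inverse of the word,
  \<open>num_smaller \<sigma> (Suc k)\<close> counts the smaller letters to the left of the letter \<open>Suc k\<close>.\<close>
definition run_class :: "nat \<Rightarrow> nat set \<Rightarrow> nat \<Rightarrow> (nat \<Rightarrow> nat) set" where
  "run_class q B i = {\<sigma>. \<sigma> permutes {1..i} \<and> (\<forall>k\<in>{q..<i}.
     if k \<in> B then num_smaller \<sigma> (Suc k) < q else q \<le> num_smaller \<sigma> (Suc k) \<and> \<sigma> k < \<sigma> (Suc k))}"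

lemma finite_run_class [simp]: "finite (run_class q B i)"
  by (rule finite_subset[OF _ finite_permutations[of "{1..i}"]]) (auto simp: run_class_def)

lemma num_smaller_append:
  assumes "\<sigma> permutes {1..i}" "k \<le> i"
  shows "num_smaller (open_gap i g \<circ> \<sigma>) k = num_smaller \<sigma> k"
proof -
  have "{j \<in> {1..<k}. (open_gap i g \<circ> \<sigma>) j < (open_gap i g \<circ> \<sigma>) k} = {j \<in> {1..<k}. \<sigma> j < \<sigma> k}"
    using assms append_less_iff[OF assms(1)] by fastforce
  then show ?thesis by (simp add: num_smaller_def)
qed

text \<open>The letters to the left of the new one are those that occupied the positions \<open>1, \<dots>, g\<close>, and
  all of them are smaller.\<close>
lemma num_smaller_append_last:
  assumes "\<sigma> permutes {1..i}" "g \<le> i"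
  shows "num_smaller (open_gap i g \<circ> \<sigma>) (Suc i) = g"
proof -
  have "{j \<in> {1..<Suc i}. (open_gap i g \<circ> \<sigma>) j < Suc g} = {j \<in> {1..i}. \<sigma> j \<in> {1..g}}"
  proof (rule Collect_cong)
    fix j
    show "j \<in> {1..<Suc i} \<and> (open_gap i g \<circ> \<sigma>) j < Suc g \<longleftrightarrow> j \<in> {1..i} \<and> \<sigma> j \<in> {1..g}"
      using permutes_in_image[OF assms(1), of j] assms by (auto simp: open_gap_def)
  qed
  also have "\<dots> = inv \<sigma> ` {1..g}"
  proof -
    have "\<sigma> j \<in> {1..g} \<Longrightarrow> j \<in> {1..i}" for j
      using permutes_in_image[OF assms(1), of j] assms(2) by auto
    then have "{j \<in> {1..i}. \<sigma> j \<in> {1..g}} = \<sigma> -` {1..g}" by auto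
    then show ?thesis by (simp add: bij_vimage_eq_inv_image permutes_bij[OF assms(1)])
  qed
  also have "card \<dots> = g"
    using card_image[of "inv \<sigma>" "{1..g}"] permutes_inj[OF permutes_inv[OF assms(1)]]
    by (simp add: inj_on_subset)
  finally show ?thesis
    using append_last[OF assms] by (simp add: num_smaller_def)
qed

text \<open>Inserting a letter keeps the relative order of the old positions, so the conditions on the
  earlier letters are unaffected and the condition on the last one is a condition on \<open>g\<close> alone.
  This gives the recursion for sums over \<open>run_class\<close> below.\<close>
lemma append_in_run_class_iff:
  assumes "1 \<le> q" "q \<le> i" "\<sigma> permutes {1..i}" "g \<le> i"
  shows "open_gap i g \<circ> \<sigma> \<in> run_class q B (Suc i) \<longleftrightarrow>
    \<sigma> \<in> run_class q B i \<and> g \<in> (if i \<in> B then {..<q} else {max (\<sigma> i) q..i})"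
proof -
  let ?\<tau> = "open_gap i g \<circ> \<sigma>"
  let ?P = "\<lambda>\<sigma> k. if k \<in> B then num_smaller \<sigma> (Suc k) < q
                     else q \<le> num_smaller \<sigma> (Suc k) \<and> \<sigma> k < \<sigma> (Suc k)"
  have old: "?P ?\<tau> k \<longleftrightarrow> ?P \<sigma> k" if "k < i" for k
    using that num_smaller_append[OF assms(3)] append_less_iff[OF assms(3)] by simp
  have "?\<tau> i < Suc g \<longleftrightarrow> \<sigma> i \<le> g"
    using permutes_le[OF assms(3), of i] by (auto simp: open_gap_def)
  then have new: "?P ?\<tau> i \<longleftrightarrow> g \<in> (if i \<in> B then {..<q} else {max (\<sigma> i) q..i})"
    using assms append_last[OF assms(3,4)] num_smaller_append_last[OF assms(3,4)] by auto
  have "{q..<Suc i} = insert i {q..<i}" using assms by auto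
  then have "?\<tau> \<in> run_class q B (Suc i) \<longleftrightarrow> (\<forall>k\<in>{q..<i}. ?P ?\<tau> k) \<and> ?P ?\<tau> i"
    using append_permutes[OF assms(3,4)]
    by (simp only: run_class_def mem_Collect_eq ball_simps simp_thms conj_commute)
  also have "\<dots> \<longleftrightarrow> (\<forall>k\<in>{q..<i}. ?P \<sigma> k) \<and> ?P ?\<tau> i"
    using old by (intro conj_cong ball_cong) auto
  finally show ?thesis
    using new assms(3) unfolding run_class_def by blast
qed

lemma sum_run_class_Suc:
  assumes "1 \<le> q" "q \<le> i"
  shows "(\<Sum>\<tau>\<in>run_class q B (Suc i). f \<tau>)
    = (\<Sum>\<sigma>\<in>run_class q B i. \<Sum>g\<in>(if i \<in> B then {..<q} else {max (\<sigma> i) q..i}).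
         f (open_gap i g \<circ> \<sigma>))"
proof -
  let ?A = "SIGMA \<sigma>:run_class q B i. if i \<in> B then {..<q} else {max (\<sigma> i) q..i}"
  let ?h = "\<lambda>(\<sigma>, g). open_gap i g \<circ> \<sigma>"
  let ?S = "{\<sigma>. \<sigma> permutes {1..i}} \<times> {..i}"
  have "run_class q B (Suc i) \<subseteq> ?h ` ?S"
    using bij_betw_imp_surj_on[OF bij_betw_append[of i]] by (auto simp: run_class_def)
  then have "run_class q B (Suc i) = ?h ` {x \<in> ?S. ?h x \<in> run_class q B (Suc i)}"
    by blast
  also have "{x \<in> ?S. ?h x \<in> run_class q B (Suc i)} = ?A"
  proof (rule set_eqI, clarify)
    fix \<sigma> g
    have "\<sigma> permutes {1..i} \<and> g \<le> i"
      if "\<sigma> \<in> run_class q B i" "g \<in> (if i \<in> B then {..<q} else {max (\<sigma> i) q..i})"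
      using that assms by (auto simp: run_class_def simp del: One_nat_def split: if_splits)
    then have "(\<sigma> permutes {1..i} \<and> g \<le> i) \<and> open_gap i g \<circ> \<sigma> \<in> run_class q B (Suc i) \<longleftrightarrow>
        \<sigma> \<in> run_class q B i \<and> g \<in> (if i \<in> B then {..<q} else {max (\<sigma> i) q..i})"
      using append_in_run_class_iff[OF assms, of \<sigma> g B] by blast
    then show "(\<sigma>, g) \<in> {x \<in> ?S. ?h x \<in> run_class q B (Suc i)} \<longleftrightarrow> (\<sigma>, g) \<in> ?A"
      by (simp del: One_nat_def)
  qed
  finally have img: "run_class q B (Suc i) = ?h ` ?A" .
  have "?A \<subseteq> ?S" using assms by (auto simp: run_class_def split: if_splits)
  then have inj: "inj_on ?h ?A"
    using bij_betw_imp_inj_on[OF bij_betw_append[of i]] inj_on_subset by blast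
  show ?thesis
    unfolding img by (subst sum.reindex[OF inj], subst sum.Sigma) (auto simp: case_prod_unfold)
qed

section \<open>Insertion statistics\<close>

text \<open>The common insertion rule of \<open>inv\<^sub>q\<close> and \<open>rmaj\<^sub>q\<close>. The argument \<open>\<sigma>\<close> is the inverse of the word
  on which the statistic is evaluated, and \<open>X i \<sigma>\<close> is a set of marked positions of that word. The
  last conjunct describes only the marks on the left of the inserted letter: every later letter of
  the same run is inserted behind these and counts each of them once.\<close>
definition insertion_statistic ::
    "nat \<Rightarrow> (nat \<Rightarrow> (nat \<Rightarrow> nat) \<Rightarrow> nat) \<Rightarrow> (nat \<Rightarrow> (nat \<Rightarrow> nat) \<Rightarrow> nat set) \<Rightarrow> bool" where
  "insertion_statistic q s X \<longleftrightarrow> (\<forall>i \<sigma>. q \<le> i \<longrightarrow> \<sigma> permutes {1..i} \<longrightarrow>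
     X i \<sigma> \<subseteq> {q..<i} \<and>
     (\<forall>g<q. s (Suc i) (open_gap i g \<circ> \<sigma>) = s i \<sigma> + (Suc i - q)) \<and>
     (\<forall>g\<in>{q..i}. s (Suc i) (open_gap i g \<circ> \<sigma>)
          = s i \<sigma> + card {d \<in> X i \<sigma>. d < g} + (if g \<in> X i \<sigma> then 0 else i - g) \<and>
        {d \<in> X (Suc i) (open_gap i g \<circ> \<sigma>). d \<le> g} = {d \<in> X i \<sigma>. d < g}))"

text \<open>The summand is the generating function of all ways to complete the word, where \<open>r\<close> letters of
  the current run are outstanding: each mark on the left of the last letter is counted once by every
  outstanding letter, these letters contribute a Gaussian binomial coefficient, and \<open>C\<close> stands for
  the later runs. Taking the maximum with \<open>q\<close> accounts for a run that has just started, since its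
  further letters may not enter the first \<open>q\<close> gaps. Undoing one insertion either lengthens the
  outstanding part of the run by one, or completes the run, in which case its whole contribution no
  longer depends on \<open>\<sigma>\<close> and is absorbed into the constant. That \<open>r'\<close> and \<open>C'\<close> are chosen before
  \<open>s\<close> and \<open>X\<close> is what allows two statistics to be compared.\<close>
lemma sum_insertion_statistic_step:
  fixes t :: "'a::comm_semiring_1"
  assumes "1 \<le> q" "q \<le> i"
  shows "\<exists>r' C'. \<forall>s X. insertion_statistic q s X \<longrightarrow>
      (\<Sum>\<tau>\<in>run_class q B (Suc i). t ^ (s (Suc i) \<tau> + r * card {d \<in> X (Suc i) \<tau>. d < \<tau> (Suc i)})
          * gauss_binom t (Suc i - max (\<tau> (Suc i)) q) r * C)
      = (\<Sum>\<sigma>\<in>run_class q B i. t ^ (s i \<sigma> + r' * card {d \<in> X i \<sigma>. d < \<sigma> i})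
          * gauss_binom t (i - max (\<sigma> i) q) r' * C')"
proof -
  define F where "F = (\<lambda>s X r C i \<sigma>. t ^ (s i \<sigma> + r * card {d \<in> X i \<sigma>. d < \<sigma> i})
          * gauss_binom t (i - max (\<sigma> i) q) r * C)"
  let ?F = "F :: (nat \<Rightarrow> (nat \<Rightarrow> nat) \<Rightarrow> nat) \<Rightarrow> (nat \<Rightarrow> (nat \<Rightarrow> nat) \<Rightarrow> nat set) \<Rightarrow> _"
  define r' where "r' = (if i \<in> B then 0 else Suc r)"
  define C' where "C' = (if i \<in> B then of_nat q * t ^ (Suc i - q) * gauss_binom t (Suc i - q) r * C else C)"
  have "(\<Sum>g\<in>(if i \<in> B then {..<q} else {max (\<sigma> i) q..i}). ?F s X r C (Suc i) (open_gap i g \<circ> \<sigma>))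
      = ?F s X r' C' i \<sigma>"
    if stat: "insertion_statistic q s X" and mem: "\<sigma> \<in> run_class q B i" for s X \<sigma>
  proof -
    have \<sigma>: "\<sigma> permutes {1..i}" using mem by (simp add: run_class_def)
    have \<sigma>i: "\<sigma> i \<le> i" using permutes_le[OF \<sigma>] by simp
    have X: "X i \<sigma> \<subseteq> {q..<i}"
      using stat assms \<sigma> by (simp add: insertion_statistic_def)
    have last: "(open_gap i g \<circ> \<sigma>) (Suc i) = Suc g" if "g \<le> i" for g
      using append_last[OF \<sigma> that] .
    show ?thesis
    proof (cases "i \<in> B")
      case True
      \<comment> \<open>A letter in one of the first \<open>q\<close> gaps has no mark on its left, and the effect on the statistic
        is the same for all these gaps.\<close>
      have "?F s X r C (Suc i) (open_gap i g \<circ> \<sigma>)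
          = t ^ (s i \<sigma> + (Suc i - q)) * gauss_binom t (Suc i - q) r * C" if g: "g < q" for g
      proof -
        have "X (Suc i) (open_gap i g \<circ> \<sigma>) \<subseteq> {q..<Suc i}"
          using stat assms append_permutes[OF \<sigma>, of g] g by (simp add: insertion_statistic_def)
        then have none: "{d \<in> X (Suc i) (open_gap i g \<circ> \<sigma>). d < Suc g} = {}" using g by auto
        have "s (Suc i) (open_gap i g \<circ> \<sigma>) = s i \<sigma> + (Suc i - q)"
          using stat assms \<sigma> g by (simp add: insertion_statistic_def)
        moreover have "max (Suc g) q = q" using g by simp
        ultimately show ?thesis
          using g assms unfolding F_def by (simp only: last none card.empty) simp
      qed
      then have "(\<Sum>g<q. ?F s X r C (Suc i) (open_gap i g \<circ> \<sigma>))
          = of_nat q * (t ^ (s i \<sigma> + (Suc i - q)) * gauss_binom t (Suc i - q) r * C)"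
        by simp
      then show ?thesis
        using True by (simp add: F_def r'_def C'_def power_add ac_simps)
    next
      case False
      let ?a = "max (\<sigma> i) q"
      let ?b = "card {d \<in> X i \<sigma>. d < \<sigma> i}"
      have fin: "finite (X i \<sigma>)" using X finite_subset by blast
      have "?F s X r C (Suc i) (open_gap i g \<circ> \<sigma>) = t ^ (s i \<sigma> + Suc r * ?b) *
          (t ^ (Suc r * card {d \<in> X i \<sigma>. ?a \<le> d \<and> d < g} + (if g \<in> X i \<sigma> then 0 else i - g))
            * gauss_binom t (i - g) r) * C" if g: "g \<in> {?a..i}" for g
      proof -
        have gi: "g \<in> {q..i}" "\<sigma> i \<le> g" using g by auto
        have st: "s (Suc i) (open_gap i g \<circ> \<sigma>)
            = s i \<sigma> + card {d \<in> X i \<sigma>. d < g} + (if g \<in> X i \<sigma> then 0 else i - g)"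
          and low: "{d \<in> X (Suc i) (open_gap i g \<circ> \<sigma>). d \<le> g} = {d \<in> X i \<sigma>. d < g}"
          using stat assms \<sigma> gi unfolding insertion_statistic_def by blast+
        \<comment> \<open>All marks are at least \<open>q\<close>, so that a mark that is not below \<open>\<sigma> i\<close> is not below \<open>?a\<close>.\<close>
        have "{d \<in> X i \<sigma>. d < g} = {d \<in> X i \<sigma>. d < \<sigma> i} \<union> {d \<in> X i \<sigma>. ?a \<le> d \<and> d < g}"
          using X gi by auto
        moreover have "{d \<in> X i \<sigma>. d < \<sigma> i} \<inter> {d \<in> X i \<sigma>. ?a \<le> d \<and> d < g} = {}" by auto
        ultimately have split: "card {d \<in> X i \<sigma>. d < g}
            = ?b + card {d \<in> X i \<sigma>. ?a \<le> d \<and> d < g}"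
          using fin by (simp add: card_Un_disjoint)
        have "max (Suc g) q = Suc g" using gi by simp
        then have "?F s X r C (Suc i) (open_gap i g \<circ> \<sigma>)
            = t ^ (s i \<sigma> + card {d \<in> X i \<sigma>. d < g} + (if g \<in> X i \<sigma> then 0 else i - g)
                 + r * card {d \<in> X i \<sigma>. d < g}) * gauss_binom t (i - g) r * C"
          using gi low unfolding F_def by (simp add: append_last[OF \<sigma>, unfolded comp_def] less_Suc_eq_le st[unfolded comp_def] comp_def)
        then show ?thesis
          by (simp add: split power_add algebra_simps)
      qed
      then have "(\<Sum>g=?a..i. ?F s X r C (Suc i) (open_gap i g \<circ> \<sigma>)) = t ^ (s i \<sigma> + Suc r * ?b) *
          (\<Sum>g=?a..i. t ^ (Suc r * card {d \<in> X i \<sigma>. ?a \<le> d \<and> d < g} + (if g \<in> X i \<sigma> then 0 else i - g))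
            * gauss_binom t (i - g) r) * C"
        unfolding sum_distrib_left sum_distrib_right by (intro sum.cong) auto
      also have "\<dots> = t ^ (s i \<sigma> + Suc r * ?b) * gauss_binom t (i - ?a) (Suc r) * C"
        using \<sigma>i assms by (subst sum_gauss_binom_marked) auto
      finally show ?thesis
        using False by (simp add: F_def r'_def C'_def)
    qed
  qed
  then have "\<forall>s X. insertion_statistic q s X \<longrightarrow>
      (\<Sum>\<tau>\<in>run_class q B (Suc i). ?F s X r C (Suc i) \<tau>) = (\<Sum>\<sigma>\<in>run_class q B i. ?F s X r' C' i \<sigma>)"
    by (simp add: sum_run_class_Suc[OF assms])
  then show ?thesis unfolding F_def by blast
qed

lemma sum_insertion_statistic:
  fixes t :: "'a::comm_semiring_1"
  assumes "1 \<le> q" "q \<le> i" "i \<le> m"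
  shows "\<exists>r C. \<forall>s X. insertion_statistic q s X \<longrightarrow>
      (\<Sum>\<tau>\<in>run_class q B m. t ^ s m \<tau>)
      = (\<Sum>\<sigma>\<in>run_class q B i. t ^ (s i \<sigma> + r * card {d \<in> X i \<sigma>. d < \<sigma> i})
          * gauss_binom t (i - max (\<sigma> i) q) r * C)"
  using assms(3,2)
proof (induction rule: inc_induct)
  case base
  show ?case by (intro exI[of _ 0] exI[of _ 1]) simp
next
  case (step i)
  then obtain r C where "\<forall>s X. insertion_statistic q s X \<longrightarrow>
      (\<Sum>\<tau>\<in>run_class q B m. t ^ s m \<tau>)
      = (\<Sum>\<sigma>\<in>run_class q B (Suc i). t ^ (s (Suc i) \<sigma> + r * card {d \<in> X (Suc i) \<sigma>. d < \<sigma> (Suc i)})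
          * gauss_binom t (Suc i - max (\<sigma> (Suc i)) q) r * C)"
    by auto
  then show ?case
    using sum_insertion_statistic_step[OF assms(1) step.prems, where B = B and t = t and r = r and C = C] by simp
qed

text \<open>On words of length \<open>q\<close> there is no room for marks, so the two sums reduce to the same sum over
  these words.\<close>
lemma insertion_statistics_equidistributed:
  fixes t :: "'a::comm_semiring_1"
  assumes "1 \<le> q" "q \<le> m"
    and "insertion_statistic q s X" "insertion_statistic q s' X'"
    and "\<And>\<sigma>. \<sigma> permutes {1..q} \<Longrightarrow> s q \<sigma> = s' q \<sigma>"
  shows "(\<Sum>\<tau>\<in>run_class q B m. t ^ s m \<tau>) = (\<Sum>\<tau>\<in>run_class q B m. t ^ s' m \<tau>)"
proof -
  obtain r C where rC: "\<And>s X. insertion_statistic q s X \<Longrightarrow> (\<Sum>\<tau>\<in>run_class q B m. t ^ s m \<tau>)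
      = (\<Sum>\<sigma>\<in>run_class q B q. t ^ (s q \<sigma> + r * card {d \<in> X q \<sigma>. d < \<sigma> q})
          * gauss_binom t (q - max (\<sigma> q) q) r * C)"
    using sum_insertion_statistic[OF assms(1) order_refl assms(2), where B = B and t = t] by blast
  have "X q \<sigma> = {}" "X' q \<sigma> = {}" if "\<sigma> permutes {1..q}" for \<sigma>
    using assms(3,4) that unfolding insertion_statistic_def by auto
  then show ?thesis
    unfolding rC[OF assms(3)] rC[OF assms(4)]
    using assms(5) by (intro sum.cong) (auto simp: run_class_def)
qed

section \<open>The two statistics under appending a letter\<close>

definition num_larger :: "(nat \<Rightarrow> nat) \<Rightarrow> nat \<Rightarrow> nat" where
  "num_larger \<pi> k = card {j \<in> {1..<k}. \<pi> j > \<pi> k}"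

lemma inv_append_open_gap:
  assumes "\<sigma> permutes {1..i}" "g \<le> i" "v \<le> i"
  shows "inv (open_gap i g \<circ> \<sigma>) (open_gap i g v) = inv \<sigma> v"
  using permutes_inverses[OF assms(1)] by (simp add: permutes_inv_eq[OF append_permutes[OF assms(1,2)]])

lemma inv_append:
  assumes "\<sigma> permutes {1..i}" "g \<le> i"
  shows "p \<le> g \<Longrightarrow> inv (open_gap i g \<circ> \<sigma>) p = inv \<sigma> p"
    and "inv (open_gap i g \<circ> \<sigma>) (Suc g) = Suc i"
    and "g < h \<Longrightarrow> h \<le> i \<Longrightarrow> inv (open_gap i g \<circ> \<sigma>) (Suc h) = inv \<sigma> h"
  using inv_append_open_gap[OF assms, of p] inv_append_open_gap[OF assms, of h]
    append_last[OF assms] assms(2)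
  by (simp_all add: open_gap_def permutes_inv_eq[OF append_permutes[OF assms]] del: comp_apply)

text \<open>The positions to the left of an old letter behind the gap are the shifted old ones and the
  position of the new letter. Comparisons in the longer word thus reduce to comparisons in the
  shorter one.\<close>
lemma positions_after_gap:
  assumes "g < h" "h \<le> i"
  shows "{1..<Suc h} = insert (Suc g) (open_gap i g ` {1..<h})"
proof (rule set_eqI)
  fix j
  show "j \<in> {1..<Suc h} \<longleftrightarrow> j \<in> insert (Suc g) (open_gap i g ` {1..<h})"
  proof
    assume j: "j \<in> {1..<Suc h}"
    consider "j = Suc g" | "j \<le> g" | "Suc g < j" by linarith
    then show "j \<in> insert (Suc g) (open_gap i g ` {1..<h})"
    proof cases
      case 2
      then have "j = open_gap i g j" "j \<in> {1..<h}" using assms j by (auto simp: open_gap_def)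
      then show ?thesis by blast
    next
      case 3
      then have "j = open_gap i g (j - 1)" "j - 1 \<in> {1..<h}"
        using assms j by (auto simp: open_gap_def)
      then show ?thesis by blast
    qed simp
  qed (use assms in \<open>auto simp: open_gap_def split: if_splits\<close>)
qed

lemma card_open_gap_image:
  assumes "g \<le> i" shows "card (open_gap i g ` A) = card A"
  by (rule card_image[OF inj_on_subset[OF permutes_inj[OF open_gap_permutes[OF assms]] subset_UNIV]])

lemma inv_append_comparisons:
  assumes "\<sigma> permutes {1..i}" "g \<le> i"
  shows "p \<le> g \<Longrightarrow> num_smaller (inv (open_gap i g \<circ> \<sigma>)) p = num_smaller (inv \<sigma>) p"
    and "p \<le> g \<Longrightarrow> num_larger (inv (open_gap i g \<circ> \<sigma>)) p = num_larger (inv \<sigma>) p"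
    and "num_smaller (inv (open_gap i g \<circ> \<sigma>)) (Suc g) = g"
    and "num_larger (inv (open_gap i g \<circ> \<sigma>)) (Suc g) = 0"
    and "g < h \<Longrightarrow> h \<le> i \<Longrightarrow> num_smaller (inv (open_gap i g \<circ> \<sigma>)) (Suc h) = num_smaller (inv \<sigma>) h"
    and "g < h \<Longrightarrow> h \<le> i \<Longrightarrow> num_larger (inv (open_gap i g \<circ> \<sigma>)) (Suc h) = Suc (num_larger (inv \<sigma>) h)"
proof -
  let ?\<pi> = "inv \<sigma>" and ?\<pi>' = "inv (open_gap i g \<circ> \<sigma>)"
  note \<pi>' = inv_append[OF assms]
  have le: "?\<pi> a < Suc i" if "a \<le> i" for a
    using permutes_le[OF permutes_inv[OF assms(1)] that] by simp
  show "num_smaller ?\<pi>' p = num_smaller ?\<pi> p" "num_larger ?\<pi>' p = num_larger ?\<pi> p" if "p \<le> g"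
    using that unfolding num_smaller_def num_larger_def by (intro arg_cong[where f = card]; auto simp: \<pi>')+
  have "{j \<in> {1..<Suc g}. ?\<pi>' j < ?\<pi>' (Suc g)} = {1..<Suc g}"
    using le assms(2) by (auto simp: \<pi>')
  then show "num_smaller ?\<pi>' (Suc g) = g" by (simp add: num_smaller_def)
  have "{j \<in> {1..<Suc g}. ?\<pi>' j > ?\<pi>' (Suc g)} = {}"
  proof -
    have "\<not> ?\<pi>' (Suc g) < ?\<pi>' j" if "j \<in> {1..<Suc g}" for j
      using that le[of j] assms(2) by (simp add: \<pi>')
    then show ?thesis by blast
  qed
  then show "num_larger ?\<pi>' (Suc g) = 0" by (simp add: num_larger_def)
  assume h: "g < h" "h \<le> i"
  have old: "?\<pi>' (open_gap i g j) = ?\<pi> j" if "j < h" for j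
    using inv_append_open_gap[OF assms, of j] that h by simp
  have "{j \<in> {1..<Suc h}. ?\<pi>' j < ?\<pi>' (Suc h)} = open_gap i g ` {j \<in> {1..<h}. ?\<pi> j < ?\<pi> h}"
    unfolding positions_after_gap[OF h] using le[of h] h old by (auto simp: \<pi>')
  then show "num_smaller ?\<pi>' (Suc h) = num_smaller ?\<pi> h"
    by (simp add: num_smaller_def card_open_gap_image[OF assms(2)])
  have "{j \<in> {1..<Suc h}. ?\<pi>' j > ?\<pi>' (Suc h)}
      = insert (Suc g) (open_gap i g ` {j \<in> {1..<h}. ?\<pi> j > ?\<pi> h})"
    unfolding positions_after_gap[OF h] using le[of h] h old by (auto simp: \<pi>')
  moreover have "Suc g \<notin> open_gap i g ` {j \<in> {1..<h}. ?\<pi> j > ?\<pi> h}"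
    using h by (auto simp: open_gap_def split: if_splits)
  ultimately show "num_larger ?\<pi>' (Suc h) = Suc (num_larger ?\<pi> h)"
    by (simp add: num_larger_def card_open_gap_image[OF assms(2)])
qed

text \<open>The new letter exceeds all others, so it has no larger letter on its left, and each letter
  behind it gains one. At the same time these letters move one place to the right, so that both
  arguments of the minimum grow by one. For \<open>g < q\<close> the letter that moves from position \<open>q\<close> to
  \<open>Suc q\<close> starts to count, with contribution one, which is why the sum below may start at \<open>q\<close>.\<close>
lemma inv_q_append:
  assumes "q \<le> i" "\<sigma> permutes {1..i}" "g \<le> i"
  shows "inv_q q (Suc i) (inv (open_gap i g \<circ> \<sigma>))
    = inv_q q i (inv \<sigma>) + (if g < q then Suc i - q else i - g)"
proof -
  let ?f = "\<lambda>p. min (p - q) (num_larger (inv \<sigma>) p)"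
  let ?f' = "\<lambda>p. min (p - q) (num_larger (inv (open_gap i g \<circ> \<sigma>)) p)"
  note cmp = inv_append_comparisons[OF assms(2,3)]
  have shift: "(\<Sum>p=Suc a..Suc i. ?f' p) = (\<Sum>h=a..i. ?f h) + (Suc i - a)"
    if "q \<le> a" "g < a" "a \<le> Suc i" for a
  proof -
    have "(\<Sum>p=Suc a..Suc i. ?f' p) = (\<Sum>h=a..i. ?f' (Suc h))"
      by (rule sum.shift_bounds_cl_Suc_ivl)
    also have "\<dots> = (\<Sum>h=a..i. ?f h + 1)"
      using that by (intro sum.cong) (auto simp: cmp Suc_diff_le)
    also have "\<dots> = (\<Sum>h=a..i. ?f h) + (Suc i - a)"
      by (simp only: sum.distrib) simp
    finally show ?thesis .
  qed
  have inv_q: "inv_q q m \<pi> = (\<Sum>p=Suc q..m. min (p - q) (num_larger \<pi> p))" for m \<pi>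
    by (simp add: inv_q_def num_larger_def)
  show ?thesis
  proof (cases "g < q")
    case True
    have "(\<Sum>h=q..i. ?f h) = (\<Sum>h=Suc q..i. ?f h)"
      using assms(1) by (simp add: sum.atLeast_Suc_atMost)
    then show ?thesis
      using shift[of q] True assms(1) by (simp add: inv_q)
  next
    case False
    have "(\<Sum>p=Suc q..Suc i. ?f' p) = (\<Sum>p=Suc q..g. ?f' p) + (\<Sum>p=Suc g..Suc i. ?f' p)"
      using sum.ub_add_nat[of "Suc q" g ?f' "Suc i - g"] False assms(3) by simp
    also have "(\<Sum>p=Suc g..Suc i. ?f' p) = (\<Sum>p=Suc (Suc g)..Suc i. ?f' p)"
      using assms(3) by (subst sum.atLeast_Suc_atMost) (simp_all add: cmp)
    also have "\<dots> = (\<Sum>h=Suc g..i. ?f h) + (i - g)"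
      using shift[of "Suc g"] False assms(3) by simp
    also have "(\<Sum>p=Suc q..g. ?f' p) = (\<Sum>p=Suc q..g. ?f p)"
      by (intro sum.cong) (auto simp: cmp)
    also have "(\<Sum>p=Suc q..g. ?f p) + ((\<Sum>h=Suc g..i. ?f h) + (i - g)) = (\<Sum>p=Suc q..i. ?f p) + (i - g)"
      using sum.ub_add_nat[of "Suc q" g ?f "i - g"] False assms(3) by simp
    finally show ?thesis
      using False by (simp only: inv_q if_False)
  qed
qed

lemma mem_Des_q_iff:
  assumes "1 \<le> q"
  shows "k \<in> Des_q q m \<pi> \<longleftrightarrow> q \<le> k \<and> k < m \<and> (\<pi> (Suc k) < \<pi> k \<or> num_smaller \<pi> (Suc k) < q)"
  using assms by (auto simp: Des_q_def Del_q_def num_smaller_def)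

text \<open>The letter pushed from position \<open>q\<close> to \<open>Suc q\<close> has fewer than \<open>q\<close> smaller letters on its left,
  so it makes \<open>q\<close> a \<open>q\<close>-descent; all other \<open>q\<close>-descents are shifted.\<close>
lemma Des_q_append_front:
  assumes "1 \<le> q" "q \<le> i" "\<sigma> permutes {1..i}" "g < q"
  shows "Des_q q (Suc i) (inv (open_gap i g \<circ> \<sigma>)) = insert q (Suc ` Des_q q i (inv \<sigma>))"
proof (rule set_eqI)
  fix k
  let ?\<pi> = "inv \<sigma>" and ?\<pi>' = "inv (open_gap i g \<circ> \<sigma>)"
  have gi: "g \<le> i" using assms by simp
  note \<pi>' = inv_append[OF assms(3) gi] inv_append_comparisons[OF assms(3) gi]
  have few: "num_smaller ?\<pi> q < q"
  proof -
    have "num_smaller ?\<pi> q \<le> card {1..<q}" unfolding num_smaller_def by (rule card_mono) auto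
    then show ?thesis using assms(1) by simp
  qed
  show "k \<in> Des_q q (Suc i) ?\<pi>' \<longleftrightarrow> k \<in> insert q (Suc ` Des_q q i ?\<pi>)"
  proof (cases k)
    case 0
    then show ?thesis using assms(1) by (auto simp: mem_Des_q_iff)
  next
    case (Suc h)
    consider "Suc h < q" | "Suc h = q" | "q \<le> h" by linarith
    then show ?thesis
    proof cases
      case 1
      then show ?thesis using assms by (auto simp: Suc mem_Des_q_iff)
    next
      case 2
      then have "num_smaller ?\<pi>' (Suc q) < q" using few assms by (simp add: \<pi>')
      then show ?thesis using 2 assms by (simp add: Suc mem_Des_q_iff)
    next
      case 3
      have "k \<in> Des_q q (Suc i) ?\<pi>' \<longleftrightarrow> h \<in> Des_q q i ?\<pi>"
        using 3 assms by (auto simp: Suc mem_Des_q_iff \<pi>')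
      then show ?thesis using 3 Suc by auto
    qed
  qed
qed

text \<open>A largest letter inserted behind position \<open>g\<close> destroys a \<open>q\<close>-descent at \<open>g\<close> and creates one
  directly behind itself, unless it is the last letter.\<close>
lemma Des_q_append_back:
  assumes "1 \<le> q" "q \<le> g" "\<sigma> permutes {1..i}" "g \<le> i"
  shows "Des_q q (Suc i) (inv (open_gap i g \<circ> \<sigma>)) = {d \<in> Des_q q i (inv \<sigma>). d < g}
    \<union> (if g < i then {Suc g} else {}) \<union> Suc ` {d \<in> Des_q q i (inv \<sigma>). g < d}"
proof (rule set_eqI)
  fix k
  let ?\<pi> = "inv \<sigma>" and ?\<pi>' = "inv (open_gap i g \<circ> \<sigma>)"
  note \<pi>' = inv_append[OF assms(3,4)] inv_append_comparisons[OF assms(3,4)]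
  have le: "?\<pi> a < Suc i" if "a \<le> i" for a
    using permutes_le[OF permutes_inv[OF assms(3)] that] by simp
  consider "k < g" | "k = g" | "k = Suc g" | "Suc g < k" by linarith
  then show "k \<in> Des_q q (Suc i) ?\<pi>' \<longleftrightarrow> k \<in> {d \<in> Des_q q i ?\<pi>. d < g}
    \<union> (if g < i then {Suc g} else {}) \<union> Suc ` {d \<in> Des_q q i ?\<pi>. g < d}" (is "_ \<longleftrightarrow> k \<in> ?rhs")
  proof cases
    case 1
    then have "k \<in> ?rhs \<longleftrightarrow> k \<in> Des_q q i ?\<pi>" by (auto split: if_splits)
    also have "\<dots> \<longleftrightarrow> k \<in> Des_q q (Suc i) ?\<pi>'"
      using 1 assms(4) by (simp add: mem_Des_q_iff[OF assms(1)] \<pi>')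
    finally show ?thesis by simp
  next
    case 2
    then have "k \<notin> ?rhs" by auto
    moreover have "k \<notin> Des_q q (Suc i) ?\<pi>'"
      using 2 assms(2,4) le[of g] by (simp add: mem_Des_q_iff[OF assms(1)] \<pi>')
    ultimately show ?thesis by simp
  next
    case 3
    then have "k \<in> ?rhs \<longleftrightarrow> g < i" by auto
    also have "\<dots> \<longleftrightarrow> k \<in> Des_q q (Suc i) ?\<pi>'"
      using 3 assms(2) le[of "Suc g"] by (auto simp: mem_Des_q_iff[OF assms(1)] \<pi>'(2) \<pi>'(3)[of "Suc g"])
    finally show ?thesis by simp
  next
    case 4
    then obtain h where h: "k = Suc h" "g < h" by (cases k) auto
    then have "k \<in> ?rhs \<longleftrightarrow> h \<in> Des_q q i ?\<pi>" by auto
    also have "\<dots> \<longleftrightarrow> k \<in> Des_q q (Suc i) ?\<pi>'"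
    proof (cases "h < i")
      case True
      then show ?thesis
        using h assms(2) \<pi>'(3)[of h] \<pi>'(3)[of "Suc h"] \<pi>'(8)[of "Suc h"]
        by (simp add: mem_Des_q_iff[OF assms(1)])
    qed (simp add: h mem_Des_q_iff[OF assms(1)])
    finally show ?thesis by simp
  qed
qed

lemma insertion_statistic_inv_q:
  "insertion_statistic q (\<lambda>i \<sigma>. inv_q q i (inv \<sigma>)) (\<lambda>i \<sigma>. {})"
  unfolding insertion_statistic_def
proof (intro allI impI conjI ballI, goal_cases)
  case (2 i \<sigma> g) then show ?case by (subst inv_q_append) auto
next
  case (3 i \<sigma> g) then show ?case by (subst inv_q_append) auto
qed auto

lemma insertion_statistic_rmaj_q:
  assumes "1 \<le> q"
  shows "insertion_statistic q (\<lambda>i \<sigma>. rmaj_q q i (inv \<sigma>)) (\<lambda>i \<sigma>. Des_q q i (inv \<sigma>))"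
  unfolding insertion_statistic_def
proof (intro allI impI conjI ballI, goal_cases)
  case (1 i \<sigma>)
  then show ?case using assms by (auto simp: mem_Des_q_iff)
next
  case (2 i \<sigma> g)
  let ?D = "Des_q q i (inv \<sigma>)"
  have "finite ?D" "q \<notin> Suc ` ?D" by (auto simp: Des_q_def)
  then show ?case
    using Des_q_append_front[OF assms 2] by (simp add: rmaj_q_def sum.reindex)
next
  case (3 i \<sigma> g)
  let ?D = "Des_q q i (inv \<sigma>)"
  let ?L = "{d \<in> ?D. d < g}" and ?R = "{d \<in> ?D. g < d}"
  let ?M = "if g < i then {Suc g} else {}"
  have fin: "finite ?D" by (auto simp: Des_q_def)
  have lt: "d < i" if "d \<in> ?D" for d using that assms by (simp add: mem_Des_q_iff)
  have "rmaj_q q (Suc i) (inv (open_gap i g \<circ> \<sigma>)) = (\<Sum>d\<in>?L \<union> ?M \<union> Suc ` ?R. Suc i - d)"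
    using Des_q_append_back[OF assms _ 3(2), of g] 3(3) by (simp add: rmaj_q_def)
  also have "\<dots> = (\<Sum>d\<in>?L. Suc i - d) + (\<Sum>d\<in>?M. Suc i - d) + (\<Sum>d\<in>Suc ` ?R. Suc i - d)"
    using fin by (subst sum.union_disjoint; (subst sum.union_disjoint)?) auto
  also have "(\<Sum>d\<in>?L. Suc i - d) = (\<Sum>d\<in>?L. (i - d) + 1)"
    using lt by (intro sum.cong) (auto simp: Suc_diff_le less_imp_le)
  also have "\<dots> = (\<Sum>d\<in>?L. i - d) + card ?L"
    by (simp only: sum.distrib) simp
  also have "(\<Sum>d\<in>?M. Suc i - d) = i - g" using 3(3) by simp
  also have "(\<Sum>d\<in>Suc ` ?R. Suc i - d) = (\<Sum>d\<in>?R. i - d)"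
    by (simp add: sum.reindex)
  also have "(\<Sum>d\<in>?L. i - d) + card ?L + (i - g) + (\<Sum>d\<in>?R. i - d)
      = (\<Sum>d\<in>?D. i - d) + card ?L + (if g \<in> ?D then 0 else i - g)"
  proof -
    have "?D = ?L \<union> (if g \<in> ?D then {g} else {}) \<union> ?R"
      by (auto simp: not_less order.order_iff_strict)
    then have "(\<Sum>d\<in>?D. i - d) = (\<Sum>d\<in>?L \<union> (if g \<in> ?D then {g} else {}) \<union> ?R. i - d)"
      by (rule arg_cong)
    also have "\<dots> = (\<Sum>d\<in>?L. i - d) + (if g \<in> ?D then i - g else 0) + (\<Sum>d\<in>?R. i - d)"
      using fin by (subst sum.union_disjoint; (subst sum.union_disjoint)?) auto
    finally show ?thesis by simp
  qed
  finally show ?case by (simp only: rmaj_q_def)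
next
  case (4 i \<sigma> g)
  then show ?case using Des_q_append_back[OF assms _ 4(2), of g] by auto
qed

section \<open>Pattern avoidance\<close>

text \<open>The last two letters of the pattern exceed all the others, so order isomorphism splits into the
  adjacent descent, the condition that the first \<open>q\<close> chosen entries are below its bottom, and
  agreement of these entries with \<open>s\<close>.\<close>
lemma contains_pat_iff:
  assumes "s permutes {1..q}"
  shows "contains_pat q m \<sigma> (map s [1..<q + 1] @ [q + 2, q + 1]) \<longleftrightarrow>
    (\<exists>i. 1 \<le> i 1 \<and> strict_mono_on {1..q + 1} i \<and> i (q + 1) < m \<and>
       \<sigma> (Suc (i (q + 1))) < \<sigma> (i (q + 1)) \<and>
       (\<forall>a\<in>{1..q}. \<sigma> (i a) < \<sigma> (Suc (i (q + 1)))) \<and>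
       (\<forall>a\<in>{1..q}. \<forall>b\<in>{1..q}. \<sigma> (i a) < \<sigma> (i b) \<longleftrightarrow> s a < s b))"
proof -
  define p where "p = map s [1..<q + 1] @ [q + 2, q + 1]"
  have "order_isomorphic (map (\<lambda>k. \<sigma> (i k)) [1..<q + 2] @ [\<sigma> (i (q + 1) + 1)]) p \<longleftrightarrow>
       \<sigma> (Suc (i (q + 1))) < \<sigma> (i (q + 1)) \<and>
       (\<forall>a\<in>{1..q}. \<sigma> (i a) < \<sigma> (Suc (i (q + 1)))) \<and>
       (\<forall>a\<in>{1..q}. \<forall>b\<in>{1..q}. \<sigma> (i a) < \<sigma> (i b) \<longleftrightarrow> s a < s b)"
    (is "order_isomorphic ?w _ \<longleftrightarrow> ?rhs") for i
  proof -
    define w where "w = ?w"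
    have len: "length w = q + 2" "length p = q + 2" by (auto simp: w_def p_def)
    have w: "w ! a = \<sigma> (i (Suc a))" if "a \<le> q" for a
      using that by (simp add: w_def nth_append del: upt_Suc)
    have w': "w ! Suc q = \<sigma> (Suc (i (q + 1)))" by (simp add: w_def nth_append del: upt_Suc)
    have p: "p ! a = s (Suc a)" if "a < q" for a
      using that by (simp add: p_def nth_append del: upt_Suc)
    have p': "p ! q = q + 2" "p ! Suc q = q + 1" by (simp_all add: p_def nth_append del: upt_Suc)
    have s: "s (Suc a) \<le> q" if "a < q" for a
      using permutes_in_image[OF assms, of "Suc a"] that by simp
    have iso: "order_isomorphic w p \<longleftrightarrow>
        (\<forall>a\<le>Suc q. \<forall>b\<le>Suc q. w ! a < w ! b \<longleftrightarrow> p ! a < p ! b)"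
      unfolding order_isomorphic_def len by (simp add: less_Suc_eq_le)
    have "order_isomorphic w p \<longleftrightarrow> ?rhs"
    proof
      assume o: "order_isomorphic w p"
      then have o: "w ! a < w ! b \<longleftrightarrow> p ! a < p ! b" if "a \<le> Suc q" "b \<le> Suc q" for a b
        using that unfolding iso by blast
      have "\<sigma> (Suc (i (q + 1))) < \<sigma> (i (q + 1))"
        using o[of "Suc q" q] w[of q] w' p' by simp
      moreover have "\<sigma> (i a) < \<sigma> (Suc (i (q + 1)))" if a: "a \<in> {1..q}" for a
      proof -
        obtain c where "a = Suc c" "c < q" using a by (cases a) auto
        then show ?thesis using o[of c "Suc q"] w[of c] w' p[of c] p' s[of c] by simp
      qed
      moreover have "\<sigma> (i a) < \<sigma> (i b) \<longleftrightarrow> s a < s b" if a: "a \<in> {1..q}" and b: "b \<in> {1..q}" for a b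
      proof -
        obtain c where "a = Suc c" "c < q" using a by (cases a) auto
        moreover obtain d where "b = Suc d" "d < q" using b by (cases b) auto
        ultimately show ?thesis using o[of c d] w[of c] w[of d] p[of c] p[of d] by simp
      qed
      ultimately show ?rhs by blast
    next
      assume r: ?rhs
      then have r1: "\<sigma> (Suc (i (q + 1))) < \<sigma> (i (q + 1))"
        and r2: "\<And>a. a < q \<Longrightarrow> \<sigma> (i (Suc a)) < \<sigma> (Suc (i (q + 1)))"
        and r3: "\<And>a b. a < q \<Longrightarrow> b < q \<Longrightarrow> \<sigma> (i (Suc a)) < \<sigma> (i (Suc b)) \<longleftrightarrow> s (Suc a) < s (Suc b)"
        by auto
      show "order_isomorphic w p"
        unfolding iso
      proof (intro allI impI)
        fix a b assume "a \<le> Suc q" "b \<le> Suc q"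
        then have "a < q \<or> a = q \<or> a = Suc q" "b < q \<or> b = q \<or> b = Suc q" by auto
        then show "w ! a < w ! b \<longleftrightarrow> p ! a < p ! b"
          using r1 r2[of a] r2[of b] r3[of a b] s[of a] s[of b] w[of a] w[of b] w[of q] w' p[of a] p[of b] p'
          by (elim disjE) simp_all
      qed
    qed
    then show ?thesis by (simp only: w_def)
  qed
  then show ?thesis unfolding contains_pat_def p_def by simp
qed

text \<open>The witness replaces each value by its rank.\<close>
lemma standardization_exists:
  fixes v :: "nat \<Rightarrow> nat"
  assumes "inj_on v {1..q}"
  shows "\<exists>s. s permutes {1..q} \<and> (\<forall>a\<in>{1..q}. \<forall>b\<in>{1..q}. v a < v b \<longleftrightarrow> s a < s b)"
proof -
  let ?I = "{1..q}"
  define s where "s a = (if a \<in> ?I then card {b \<in> ?I. v b \<le> v a} else a)" for a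
  have mono: "s a < s b" if "a \<in> ?I" "b \<in> ?I" "v a < v b" for a b
  proof -
    have "b \<in> {c \<in> ?I. v c \<le> v b}" "b \<notin> {c \<in> ?I. v c \<le> v a}" using that by auto
    moreover have "{c \<in> ?I. v c \<le> v a} \<subseteq> {c \<in> ?I. v c \<le> v b}" using that by auto
    ultimately have "{c \<in> ?I. v c \<le> v a} \<subset> {c \<in> ?I. v c \<le> v b}" by blast
    then have "card {c \<in> ?I. v c \<le> v a} < card {c \<in> ?I. v c \<le> v b}"
      by (rule psubset_card_mono[rotated]) simp
    then show ?thesis using that(1,2) by (simp only: s_def if_True)
  qed
  have iff: "v a < v b \<longleftrightarrow> s a < s b" if "a \<in> ?I" "b \<in> ?I" for a b
    using mono[OF that] mono[OF that(2,1)] inj_onD[OF assms _ that]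
    by (metis less_irrefl linorder_neqE_nat order.asym)
  have "s a \<in> ?I" if "a \<in> ?I" for a
  proof -
    have "{b \<in> ?I. v b \<le> v a} \<noteq> {}" using that by auto
    then have "0 < card {b \<in> ?I. v b \<le> v a}" by (simp add: card_gt_0_iff)
    moreover have "card {b \<in> ?I. v b \<le> v a} \<le> card ?I" by (rule card_mono) auto
    ultimately show ?thesis using that by (simp add: s_def)
  qed
  moreover have "inj_on s ?I"
    using iff inj_onD[OF assms] by (intro inj_onI) (metis less_irrefl linorder_neqE_nat)
  ultimately have "bij_betw s ?I ?I"
    by (simp add: bij_betw_def endo_inj_surj image_subset_iff)
  then have "s permutes ?I"
    by (rule bij_imp_permutes) (simp only: s_def if_False)
  then show ?thesis using iff by blast
qed

text \<open>As \<open>Pat q\<close> contains every arrangement of the first \<open>q\<close> letters, any \<open>q\<close> smaller entries on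
  the left of a descent bottom complete an occurrence.\<close>
lemma contains_some_Pat_iff:
  assumes "1 \<le> q" "\<sigma> permutes {1..m}"
  shows "(\<exists>p\<in>Pat q. contains_pat q m \<sigma> p) \<longleftrightarrow>
    (\<exists>k\<in>{1..<m}. \<sigma> (Suc k) < \<sigma> k \<and> q \<le> num_smaller \<sigma> (Suc k))"
proof
  assume "\<exists>p\<in>Pat q. contains_pat q m \<sigma> p"
  then obtain i where i: "1 \<le> i 1" "strict_mono_on {1..q + 1} i" "i (q + 1) < m"
      "\<sigma> (Suc (i (q + 1))) < \<sigma> (i (q + 1))" "\<forall>a\<in>{1..q}. \<sigma> (i a) < \<sigma> (Suc (i (q + 1)))"
    unfolding Pat_def using contains_pat_iff by blast
  let ?k = "i (q + 1)"
  have less: "i a < i b" if "1 \<le> a" "a < b" "b \<le> q + 1" for a b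
    using i(2) that by (auto simp: strict_mono_on_def)
  have ge: "1 \<le> i a" if "1 \<le> a" "a \<le> q + 1" for a
    using less[of 1 a] that i(1) by (cases "a = 1") auto
  have "i a \<in> {j \<in> {1..<Suc ?k}. \<sigma> j < \<sigma> (Suc ?k)}" if "a \<in> {1..q}" for a
    using i(5) that ge[of a] less[of a "q + 1"] by simp
  then have "i ` {1..q} \<subseteq> {j \<in> {1..<Suc ?k}. \<sigma> j < \<sigma> (Suc ?k)}" by blast
  then have "card (i ` {1..q}) \<le> num_smaller \<sigma> (Suc ?k)"
    unfolding num_smaller_def by (rule card_mono[rotated]) simp
  moreover have "inj_on i {1..q}"
    using strict_mono_on_imp_inj_on[OF i(2)] by (rule inj_on_subset) auto
  ultimately have "q \<le> num_smaller \<sigma> (Suc ?k)" by (simp add: card_image)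
  then show "\<exists>k\<in>{1..<m}. \<sigma> (Suc k) < \<sigma> k \<and> q \<le> num_smaller \<sigma> (Suc k)"
    using i(3,4) ge[of "q + 1"] by auto
next
  assume "\<exists>k\<in>{1..<m}. \<sigma> (Suc k) < \<sigma> k \<and> q \<le> num_smaller \<sigma> (Suc k)"
  then obtain k where k: "1 \<le> k" "k < m" "\<sigma> (Suc k) < \<sigma> k" "q \<le> num_smaller \<sigma> (Suc k)" by auto
  obtain S where S: "S \<subseteq> {j \<in> {1..<Suc k}. \<sigma> j < \<sigma> (Suc k)}" "card S = q" "finite S"
    using obtain_subset_with_card_n[OF k(4)[unfolded num_smaller_def]] by blast
  define i where "i a = (if a \<le> q then sorted_list_of_set S ! (a - 1) else k)" for a
  have Sk: "j < k" if "j \<in> S" for j using S(1) that k(3) by (auto simp: less_Suc_eq)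
  have mem: "i a \<in> S" if "a \<in> {1..q}" for a
  proof -
    have "a - 1 < length (sorted_list_of_set S)" using that S by auto
    from nth_mem[OF this] have "sorted_list_of_set S ! (a - 1) \<in> S"
      unfolding set_sorted_list_of_set[OF S(3)] .
    then show ?thesis using that by (simp add: i_def)
  qed
  have mono: "strict_mono_on {1..q + 1} i"
  proof (rule strict_mono_onI)
    fix a b assume ab: "a \<in> {1..q + 1}" "b \<in> {1..q + 1}" "a < b"
    show "i a < i b"
    proof (cases "b \<le> q")
      case True
      then have "a - 1 < b - 1" "b - 1 < length (sorted_list_of_set S)" using ab S by auto
      then have "sorted_list_of_set S ! (a - 1) < sorted_list_of_set S ! (b - 1)"
        by (rule sorted_wrt_nth_less[OF strict_sorted_list_of_set])
      then show ?thesis using True ab by (simp add: i_def)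
    next
      case False
      then have "i b = k" "a \<in> {1..q}" using ab by (auto simp: i_def)
      then show ?thesis using Sk mem by simp
    qed
  qed
  have "inj_on i {1..q}"
    using strict_mono_on_imp_inj_on[OF mono] by (rule inj_on_subset) auto
  from comp_inj_on[OF this inj_on_subset[OF permutes_inj[OF assms(2)] subset_UNIV]]
  have "inj_on (\<lambda>a. \<sigma> (i a)) {1..q}" by (simp only: comp_def)
  then obtain s where s: "s permutes {1..q}"
      "\<forall>a\<in>{1..q}. \<forall>b\<in>{1..q}. \<sigma> (i a) < \<sigma> (i b) \<longleftrightarrow> s a < s b"
    using standardization_exists[of "\<lambda>a. \<sigma> (i a)" q] by blast
  have "1 \<le> i 1" using mem[of 1] S(1) assms(1) by auto
  moreover have "\<forall>a\<in>{1..q}. \<sigma> (i a) < \<sigma> (Suc k)" using mem S(1) by blast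
  moreover have "i (q + 1) = k" by (simp add: i_def)
  ultimately have "contains_pat q m \<sigma> (map s [1..<q + 1] @ [q + 2, q + 1])"
    unfolding contains_pat_iff[OF s(1)] using mono k s(2) by (intro exI[of _ i]) simp
  then show "\<exists>p\<in>Pat q. contains_pat q m \<sigma> p"
    unfolding Pat_def using s(1) by blast
qed

text \<open>Avoidance turns a descent at \<open>k\<close> into \<open>Suc k \<in> Del_q q m \<sigma>\<close>, hence \<open>B\<close> records
  exactly where \<open>num_smaller \<sigma> (Suc k) < q\<close> holds, and \<open>\<sigma>\<close> ascends everywhere else.\<close>
lemma Avoid_q_Des_q_eq_run_class:
  assumes "1 \<le> q" "B \<subseteq> {q..<m}"
  shows "{\<sigma> \<in> Avoid_q q m. Des_q q m \<sigma> = B} = run_class q B m"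
proof (rule set_eqI)
  fix \<sigma> :: "nat \<Rightarrow> nat"
  show "\<sigma> \<in> {\<sigma> \<in> Avoid_q q m. Des_q q m \<sigma> = B} \<longleftrightarrow> \<sigma> \<in> run_class q B m"
  proof (cases "\<sigma> permutes {1..m}")
    case True
    have neq: "\<sigma> (Suc k) \<noteq> \<sigma> k" for k
      using inj_eq[OF permutes_inj[OF True]] by simp
    have few: "num_smaller \<sigma> (Suc k) < q" if "k < q" for k
    proof -
      have "num_smaller \<sigma> (Suc k) \<le> card {1..<Suc k}" unfolding num_smaller_def by (rule card_mono) auto
      then show ?thesis using that by simp
    qed
    have "\<sigma> \<in> Avoid_q q m \<longleftrightarrow> (\<forall>k\<in>{1..<m}. \<sigma> (Suc k) < \<sigma> k \<longrightarrow> num_smaller \<sigma> (Suc k) < q)"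
      using contains_some_Pat_iff[OF assms(1) True] True unfolding Avoid_q_def
      by (auto simp: not_le)
    also have "\<dots> \<longleftrightarrow> (\<forall>k\<in>{q..<m}. \<sigma> (Suc k) < \<sigma> k \<longrightarrow> num_smaller \<sigma> (Suc k) < q)"
      using few assms(1) by (auto simp: not_le)
    finally have av: "\<sigma> \<in> Avoid_q q m \<longleftrightarrow> \<dots>" .
    have "Des_q q m \<sigma> = B \<longleftrightarrow>
        (\<forall>k\<in>{q..<m}. k \<in> B \<longleftrightarrow> \<sigma> (Suc k) < \<sigma> k \<or> num_smaller \<sigma> (Suc k) < q)"
      using assms by (auto simp: mem_Des_q_iff set_eq_iff)
    then have "\<sigma> \<in> {\<sigma> \<in> Avoid_q q m. Des_q q m \<sigma> = B} \<longleftrightarrow>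
        (\<forall>k\<in>{q..<m}. (\<sigma> (Suc k) < \<sigma> k \<longrightarrow> num_smaller \<sigma> (Suc k) < q) \<and>
           (k \<in> B \<longleftrightarrow> \<sigma> (Suc k) < \<sigma> k \<or> num_smaller \<sigma> (Suc k) < q))"
      using av by blast
    also have "\<dots> \<longleftrightarrow> (\<forall>k\<in>{q..<m}. if k \<in> B then num_smaller \<sigma> (Suc k) < q
          else q \<le> num_smaller \<sigma> (Suc k) \<and> \<sigma> k < \<sigma> (Suc k))"
    proof (rule ball_cong[OF refl])
      fix k
      show "(\<sigma> (Suc k) < \<sigma> k \<longrightarrow> num_smaller \<sigma> (Suc k) < q) \<and>
           (k \<in> B \<longleftrightarrow> \<sigma> (Suc k) < \<sigma> k \<or> num_smaller \<sigma> (Suc k) < q) \<longleftrightarrow>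
         (if k \<in> B then num_smaller \<sigma> (Suc k) < q else q \<le> num_smaller \<sigma> (Suc k) \<and> \<sigma> k < \<sigma> (Suc k))"
        using neq[of k] by auto
    qed
    finally show ?thesis using True by (simp add: run_class_def)
  qed (auto simp: Avoid_q_def run_class_def)
qed

section \<open>Equidistribution\<close>

theorem theorem11p7:
  fixes n q :: nat and B :: "nat set"
  assumes "n \<ge> 1" and "q \<ge> 1"
    and "B \<subseteq> {q..n + q - 2}"
  shows "(\<Sum>\<pi> | \<pi> permutes {1..n + q - 1} \<and> inv \<pi> \<in> Avoid_q q (n + q - 1)
              \<and> Des_q q (n + q - 1) (inv \<pi>) = B.
            monom (1 :: int) (rmaj_q q (n + q - 1) \<pi>))
       = (\<Sum>\<pi> | \<pi> permutes {1..n + q - 1} \<and> inv \<pi> \<in> Avoid_q q (n + q - 1)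
              \<and> Des_q q (n + q - 1) (inv \<pi>) = B.
            monom (1 :: int) (inv_q q (n + q - 1) \<pi>))"
proof -
  let ?m = "n + q - 1"
  let ?t = "monom (1 :: int) 1"
  have B: "B \<subseteq> {q..<?m}" and m: "q \<le> ?m" using assms by (auto simp: subset_iff)
  have by_inverse: "(\<Sum>\<pi> | \<pi> permutes {1..?m} \<and> inv \<pi> \<in> Avoid_q q ?m \<and> Des_q q ?m (inv \<pi>) = B.
      monom (1 :: int) (st \<pi>)) = (\<Sum>\<sigma>\<in>run_class q B ?m. ?t ^ st (inv \<sigma>))" for st
  proof (rule sum.reindex_bij_witness[where i = inv and j = inv])
    fix \<sigma> assume "\<sigma> \<in> run_class q B ?m"
    then have \<sigma>: "\<sigma> permutes {1..?m}" "\<sigma> \<in> Avoid_q q ?m" "Des_q q ?m \<sigma> = B"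
      using Avoid_q_Des_q_eq_run_class[OF assms(2) B] by (auto simp: Avoid_q_def)
    then show "inv (inv \<sigma>) = \<sigma>" by (simp add: permutes_inv_inv)
    then show "inv \<sigma> \<in> {\<pi>. \<pi> permutes {1..?m} \<and> inv \<pi> \<in> Avoid_q q ?m \<and> Des_q q ?m (inv \<pi>) = B}"
      using \<sigma> by (simp add: permutes_inv)
  next
    fix \<pi> assume \<pi>: "\<pi> \<in> {\<pi>. \<pi> permutes {1..?m} \<and> inv \<pi> \<in> Avoid_q q ?m \<and> Des_q q ?m (inv \<pi>) = B}"
    then show "inv (inv \<pi>) = \<pi>" by (auto simp: permutes_inv_inv)
    then show "?t ^ st (inv (inv \<pi>)) = monom 1 (st \<pi>)" by (simp add: monom_power)
    show "inv \<pi> \<in> run_class q B ?m"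
      using \<pi> Avoid_q_Des_q_eq_run_class[OF assms(2) B] by blast
  qed
  have "rmaj_q q q \<pi> = inv_q q q \<pi>" for \<pi>
    using assms(2) by (simp add: rmaj_q_def inv_q_def Des_q_def)
  then show ?thesis
    unfolding by_inverse
    by (intro insertion_statistics_equidistributed[OF assms(2) m insertion_statistic_rmaj_q[OF assms(2)]
          insertion_statistic_inv_q])
qed

end
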